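(* For every integer $k\ge 2$ the following hold as $n\to\infty$ (each $o(n)$ denotes a function $f(n)$ with $f(n)/n\to 0$, depending on $k$): \begin{itemize} \item if $k\in\{2,3,5\}$, then $H(n,2k)\le n^{\left(1-\frac{1}{k^2}\right)n-o(n)}$; \item if $k\notin\{2,3,5\}$ and $k$ is even, then $H(n,2k)\le n^{\left(1-\frac{2}{3k^2-2k}\right)n-o(n)}$; \item if $k\notin\{2,3,5\}$ and $k$ is odd, then $H(n,2k)\le n^{\left(1-\frac{2}{3k^2-3k}\right)n-o(n)}$. \end{itemize}
   Context: Two graphs $H_1,H_2$ on the same vertex set are called $G$-creating if their union $H_1\cup H_2$ (the graph on that vertex set whose edge set is the union of their edge sets) contains $G$ as a subgraph. A family of graphs is pairwise $G$-creating if every two distinct members are $G$-creating. $C_\ell$ denotes the cycle of length $\ell$. $H(n,\ell)$ denotes the maximum number of pairwise $C_\ell$-creating paths (of arbitrary length) on the vertex set $[n]=\{1,\dots,n\}$; equivalently, the maximum number of pairwise $C_\ell$-creating Hamiltonian paths of the complete graph $K_n$. *)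

theory Defs
  imports Complex_Main
begin

text \<open>A simple graph is a pair of a vertex set and a set of two-element subsets of it.\<close>

type_synonym 'a sgraph = "'a set \<times> 'a set set"

abbreviation vertices :: "'a sgraph \<Rightarrow> 'a set" where
  "vertices G \<equiv> fst G"

abbreviation edges :: "'a sgraph \<Rightarrow> 'a set set" where
  "edges G \<equiv> snd G"

text \<open>Containment as a (not necessarily induced) subgraph, up to isomorphism.\<close>

definition contains_copy :: "'a sgraph \<Rightarrow> 'b sgraph \<Rightarrow> bool" where
  "contains_copy H G \<longleftrightarrow>
     (\<exists>f. inj_on f (vertices G) \<and> f ` vertices G \<subseteq> vertices H \<and>
          (\<forall>e \<in> edges G. f ` e \<in> edges H))"

definition graph_union :: "'a sgraph \<Rightarrow> 'a sgraph \<Rightarrow> 'a sgraph" where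
  "graph_union H1 H2 = (vertices H1 \<union> vertices H2, edges H1 \<union> edges H2)"

definition creating :: "'b sgraph \<Rightarrow> 'a sgraph \<Rightarrow> 'a sgraph \<Rightarrow> bool" where
  "creating G H1 H2 \<longleftrightarrow>
     vertices H1 = vertices H2 \<and> contains_copy (graph_union H1 H2) G"

text \<open>This is the cycle of length \<open>l\<close> for \<open>l \<ge> 3\<close>; smaller values of \<open>l\<close> are degenerate.\<close>

definition cycle_graph :: "nat \<Rightarrow> nat sgraph" where
  "cycle_graph l = ({0..<l}, {{i, Suc i mod l} | i. i < l})"

definition path_edges :: "'a list \<Rightarrow> 'a set set" where
  "path_edges p = {{p ! i, p ! Suc i} | i. Suc i < length p}"

text \<open>Paths of arbitrary length in \<open>{1..n}\<close>, each regarded as a graph on the whole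
  vertex set \<open>{1..n}\<close>: vertices off the path are isolated. A path and its reversal
  are the same graph.\<close>

definition paths_on :: "nat \<Rightarrow> nat sgraph set" where
  "paths_on n =
     {({1..n}, path_edges p) | p. p \<noteq> [] \<and> distinct p \<and> set p \<subseteq> {1..n}}"

definition H :: "nat \<Rightarrow> nat \<Rightarrow> nat" where
  "H n l = Max {card F | F. F \<subseteq> paths_on n \<and> pairwise (creating (cycle_graph l)) F}"

lemma finite_paths_on: "finite (paths_on n)"
proof -
  have "path_edges p \<subseteq> Pow {1..n}" if p: "set p \<subseteq> {1..n}" for p :: "nat list"
  proof
    fix e assume "e \<in> path_edges p"
    then obtain i where i: "Suc i < length p" and e: "e = {p ! i, p ! Suc i}"
      unfolding path_edges_def by blast
    have "p ! i \<in> set p" "p ! Suc i \<in> set p"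
      using i by simp_all
    then show "e \<in> Pow {1..n}" using p e by blast
  qed
  then have "paths_on n \<subseteq> {{1..n}} \<times> Pow (Pow {1..n})"
    unfolding paths_on_def by blast
  then show ?thesis
    by (rule finite_subset) (intro finite_cartesian_product, simp_all)
qed

text \<open>The maximum defining \<^const>\<open>H\<close> is over a finite nonempty set, hence attained.\<close>

lemma H_attained:
  "\<exists>F \<subseteq> paths_on n. pairwise (creating (cycle_graph l)) F \<and> card F = H n l"
  and H_upper:
  "F \<subseteq> paths_on n \<Longrightarrow> pairwise (creating (cycle_graph l)) F \<Longrightarrow> card F \<le> H n l"
proof -
  let ?A = "{card F | F. F \<subseteq> paths_on n \<and> pairwise (creating (cycle_graph l)) F}"
  have "?A \<subseteq> card ` Pow (paths_on n)" by auto
  then have fin: "finite ?A"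
    by (rule finite_subset) (simp add: finite_paths_on)
  have "card ({} :: nat sgraph set) \<in> ?A"
    by (rule CollectI, rule exI[of _ "{}"]) simp
  then have "Max ?A \<in> ?A" using fin Max_in by blast
  then show "\<exists>F \<subseteq> paths_on n. pairwise (creating (cycle_graph l)) F \<and> card F = H n l"
    unfolding H_def by (smt (verit) mem_Collect_eq)
  show "card F \<le> H n l"
    if "F \<subseteq> paths_on n" "pairwise (creating (cycle_graph l)) F"
    unfolding H_def using fin that by (intro Max_ge) blast+
qed

end

theory Submission
  imports Defs "HOL-Real_Asymp.Real_Asymp"
begin

text \<open>
  A \<open>C\<^bsub>2k\<^esub>\<close>-free graph contains at most one member of a pairwise
  \<open>C\<^bsub>2k\<^esub>\<close>-creating family, so a family is small once every path lies in a random
  \<open>C\<^bsub>2k\<^esub>\<close>-free graph with large probability. Take the random graph on \<open>n\<close> vertices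
  with edge probability \<open>p = d / n\<close>, where \<open>d\<^bsup>2k\<^esup> = n / ln n\<close>. It contains a given path \<open>P\<close>
  with probability at least \<open>p\<^bsup>n\<^esup>\<close>. Given this, the expected number of \<open>2k\<close>-cycles is at most
  \<open>d (d + 2)\<^bsup>2k - 1\<^esup> = o(n)\<close>: each of them has an edge outside \<open>P\<close>, and walking along the
  remaining edges costs a factor \<open>d + 2\<close> per step, \<open>2\<close> for the edges of \<open>P\<close> and \<open>d\<close> for the
  random ones. Deleting one edge outside \<open>P\<close> from each cycle leaves a \<open>C\<^bsub>2k\<^esub>\<close>-free graph
  containing \<open>P\<close>, and the set of \<open>o(n)\<close> deleted edges can be chosen in only \<open>n\<^bsup>o(n)\<^esup>\<close> ways.
  Hence \<open>H(n, 2k) \<le> p\<^bsup>-n\<^esup> n\<^bsup>o(n)\<^esup> = n\<^bsup>(1 - 1/(2k)) n + o(n)\<^esup>\<close>, which is at least as strong as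
  each of the three bounds.
\<close>

section \<open>Random subsets of a finite set\<close>

text \<open>For \<open>G\<close> inside \<open>E\<close> this is the probability that
  \<open>G\<close> is the outcome when each element of \<open>E\<close> is kept independently with
  probability \<open>p\<close>. Probabilities and expectations are written below as finite sums of
  these weights.\<close>

definition bernoulli_weight :: "real \<Rightarrow> 'a set \<Rightarrow> 'a set \<Rightarrow> real" where
  "bernoulli_weight p E G = p ^ card G * (1 - p) ^ card (E - G)"

lemma bernoulli_weight_nonneg:
  "0 \<le> p \<Longrightarrow> p \<le> 1 \<Longrightarrow> 0 \<le> bernoulli_weight p E G"
  by (simp add: bernoulli_weight_def)

text \<open>Supersets of \<open>S\<close> are the sets \<open>S \<union> B\<close> with
  \<open>B\<close> inside \<open>E - S\<close>. Each contributes the factor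
  \<open>p ^ card S\<close>, and the remaining sum over \<open>B\<close> is the expansion of a
  product of factors \<open>p + (1 - p) = 1\<close>. For \<open>S = {}\<close> this is the total
  mass.\<close>

lemma sum_bernoulli_weight_superset:
  assumes fin: "finite E" and S: "S \<subseteq> E"
  shows "(\<Sum>G | G \<subseteq> E \<and> S \<subseteq> G. bernoulli_weight p E G) = p ^ card S"
proof -
  have finS: "finite S" using S fin finite_subset by blast
  have eq: "{G. G \<subseteq> E \<and> S \<subseteq> G} = (\<union>) S ` Pow (E - S)"
  proof
    show "{G. G \<subseteq> E \<and> S \<subseteq> G} \<subseteq> (\<union>) S ` Pow (E - S)"
    proof
      fix G assume "G \<in> {G. G \<subseteq> E \<and> S \<subseteq> G}"
      then have "G = S \<union> (G - S)" "G - S \<in> Pow (E - S)" by auto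
      then show "G \<in> (\<union>) S ` Pow (E - S)" by blast
    qed
  qed (use S in auto)
  have inj: "inj_on ((\<union>) S) (Pow (E - S))"
    by (rule inj_onI) blast
  have "(\<Sum>G | G \<subseteq> E \<and> S \<subseteq> G. bernoulli_weight p E G)
      = (\<Sum>B \<in> Pow (E - S). bernoulli_weight p E (S \<union> B))"
    unfolding eq by (simp add: sum.reindex[OF inj])
  also have "\<dots> = (\<Sum>B \<in> Pow (E - S). p ^ card S * (p ^ card B * (1 - p) ^ card (E - S - B)))"
  proof (rule sum.cong[OF refl])
    fix B assume B: "B \<in> Pow (E - S)"
    then have "finite B" using fin finite_subset by blast
    then have "card (S \<union> B) = card S + card B"
      using B finS by (intro card_Un_disjoint) auto
    moreover have "E - (S \<union> B) = E - S - B" by blast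
    ultimately show "bernoulli_weight p E (S \<union> B)
        = p ^ card S * (p ^ card B * (1 - p) ^ card (E - S - B))"
      by (simp add: bernoulli_weight_def power_add)
  qed
  also have "\<dots> = p ^ card S * (\<Sum>B \<in> Pow (E - S). (\<Prod>e\<in>B. p) * (\<Prod>e\<in>E - S - B. 1 - p))"
    by (simp add: sum_distrib_left)
  also have "(\<Sum>B \<in> Pow (E - S). (\<Prod>e\<in>B. p) * (\<Prod>e\<in>E - S - B. 1 - p))
      = (\<Prod>e\<in>E - S. p + (1 - p))"
    using fin by (subst prod_add) auto
  finally show ?thesis by simp
qed

section \<open>Counting weighted walks and small subsets\<close>

text \<open>Peel off the first vertex: its factor involves only itself and the next vertex, so
  summing over it costs at most \<open>D\<close>. After \<open>m\<close> such steps only the last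
  vertex is left, with \<open>card V\<close> choices.\<close>

lemma sum_walk_weights_le:
  fixes a :: "'a \<Rightarrow> 'a \<Rightarrow> real" and D :: real
  assumes fin: "finite V"
    and nonneg: "\<And>u v. 0 \<le> a u v"
    and col: "\<And>v. v \<in> V \<Longrightarrow> (\<Sum>u\<in>V. a u v) \<le> D"
  shows "(\<Sum>xs | set xs \<subseteq> V \<and> length xs = Suc m. \<Prod>i<m. a (xs ! i) (xs ! Suc i))
           \<le> card V * D ^ m"
proof (induction m)
  case 0
  then show ?case using card_lists_length_eq[OF fin, of 1] by simp
next
  case (Suc m)
  let ?L = "\<lambda>m. {xs. set xs \<subseteq> V \<and> length xs = m}"
  let ?w = "\<lambda>xs m. \<Prod>i<m. a (xs ! i) (xs ! Suc i)"
  have finL: "finite (?L j)" for j using finite_lists_length_eq[OF fin] .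
  have eq: "?L (Suc (Suc m)) = (\<lambda>(x, ys). x # ys) ` (V \<times> ?L (Suc m))"
    by (auto simp: length_Suc_conv image_iff)
  have inj: "inj_on (\<lambda>(x, ys). x # ys) (V \<times> ?L (Suc m))"
    by (auto simp: inj_on_def)
  have "(\<Sum>xs\<in>?L (Suc (Suc m)). ?w xs (Suc m))
      = (\<Sum>(x, ys)\<in>V \<times> ?L (Suc m). ?w (x # ys) (Suc m))"
    unfolding eq by (subst sum.reindex[OF inj]) (simp add: case_prod_unfold)
  also have "\<dots> = (\<Sum>ys\<in>?L (Suc m). \<Sum>x\<in>V. ?w (x # ys) (Suc m))"
    by (subst sum.cartesian_product[symmetric], rule sum.swap)
  also have "\<dots> = (\<Sum>ys\<in>?L (Suc m). (\<Sum>x\<in>V. a x (ys ! 0)) * ?w ys m)"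
    by (simp add: prod.lessThan_Suc_shift sum_distrib_right del: prod.lessThan_Suc)
  also have "\<dots> \<le> (\<Sum>ys\<in>?L (Suc m). D * ?w ys m)"
  proof (intro sum_mono mult_right_mono prod_nonneg ballI nonneg)
    fix ys assume ys: "ys \<in> ?L (Suc m)"
    then have "ys ! 0 \<in> set ys" by (intro nth_mem) simp
    then show "(\<Sum>x\<in>V. a x (ys ! 0)) \<le> D" using ys by (intro col) auto
  qed
  also have "\<dots> = D * (\<Sum>ys\<in>?L (Suc m). ?w ys m)"
    by (simp add: sum_distrib_left)
  also have "\<dots> \<le> D * (card V * D ^ m)"
  \<comment> \<open>Multiplying the induction hypothesis by \<open>D\<close> needs \<open>D\<close>
    nonnegative, which the column bound yields only if some vertex exists.\<close>
  proof (cases "V = {}")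
    case False
    then obtain v where "v \<in> V" by blast
    then have "0 \<le> D" using col[of v] sum_nonneg[of V "\<lambda>u. a u v"] nonneg by force
    then show ?thesis using Suc.IH by (intro mult_left_mono) auto
  next
    case True
    then have "?L (Suc m) = {}" by auto
    then show ?thesis using True by (simp only: sum.empty) simp
  qed
  finally show ?case by (simp add: algebra_simps)
qed

text \<open>Such a subset can be read off from a list of length exactly \<open>s\<close> over
  \<open>A\<close> and one extra symbol \<open>None\<close>, which pads the list when the subset is
  smaller.\<close>

lemma card_subsets_le:
  assumes fin: "finite A"
  shows "card {D. D \<subseteq> A \<and> card D \<le> s} \<le> (card A + 1) ^ s"
proof -
  let ?B = "insert None (Some ` A)"
  let ?L = "{xs. set xs \<subseteq> ?B \<and> length xs = s}"
  have "{D. D \<subseteq> A \<and> card D \<le> s} \<subseteq> (\<lambda>xs. {x. Some x \<in> set xs}) ` ?L"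
  proof
    fix D assume "D \<in> {D. D \<subseteq> A \<and> card D \<le> s}"
    then have D: "D \<subseteq> A" "card D \<le> s" by auto
    then have "finite D" using fin finite_subset by blast
    then obtain ds where ds: "set ds = D" "distinct ds"
      using finite_distinct_list by blast
    then have "length ds \<le> s" using D distinct_card by metis
    then have "map Some ds @ replicate (s - length ds) None \<in> ?L"
      using ds D by auto
    moreover have "D = {x. Some x \<in> set (map Some ds @ replicate (s - length ds) None)}"
      using ds by auto
    ultimately show "D \<in> (\<lambda>xs. {x. Some x \<in> set xs}) ` ?L" by blast
  qed
  moreover have finL: "finite ?L" using fin by (intro finite_lists_length_eq) auto
  ultimately have "card {D. D \<subseteq> A \<and> card D \<le> s} \<le> card ?L"
    by (meson surj_card_le)
  also have "\<dots> = (card A + 1) ^ s"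
    using fin by (subst card_lists_length_eq) (auto simp: card_image)
  finally show ?thesis .
qed

section \<open>Paths have maximum degree two and contain no cycle\<close>

lemma card_path_neighbours_le:
  assumes "distinct ps"
  shows "finite {u. {u, v} \<in> path_edges ps}" and "card {u. {u, v} \<in> path_edges ps} \<le> 2"
proof -
  have "\<exists>a b. {u. {u, v} \<in> path_edges ps} \<subseteq> {a, b}"
  proof (cases "v \<in> set ps")
    case True
    then obtain j where j: "j < length ps" "ps ! j = v" by (auto simp: in_set_conv_nth)
    \<comment> \<open>At an end of the path one of these two entries is not a neighbour
      (\<open>j - 1\<close> is \<open>0\<close> for \<open>j = 0\<close>, and \<open>Suc j\<close>
      may be out of range). This is harmless, since only an inclusion is claimed.\<close>
    have "u \<in> {ps ! (j - 1), ps ! Suc j}" if uv: "{u, v} \<in> path_edges ps" for u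
    proof -
      obtain i where i: "Suc i < length ps" "{u, v} = {ps ! i, ps ! Suc i}"
        using uv unfolding path_edges_def by blast
      then consider "u = ps ! i" "v = ps ! Suc i" | "u = ps ! Suc i" "v = ps ! i"
        by (auto simp: doubleton_eq_iff)
      then show ?thesis
      proof cases
        case 1
        then have "Suc i = j" using i j assms nth_eq_iff_index_eq by metis
        then show ?thesis using 1 by auto
      next
        case 2
        then have "i = j" using i j assms nth_eq_iff_index_eq Suc_lessD by metis
        then show ?thesis using 2 by auto
      qed
    qed
    then show ?thesis by blast
  next
    case False
    have "v \<in> set ps" if uv: "{u, v} \<in> path_edges ps" for u
    proof -
      obtain i where "Suc i < length ps" "{u, v} = {ps ! i, ps ! Suc i}"
        using uv unfolding path_edges_def by blast
      then show ?thesis by (metis Suc_lessD doubleton_eq_iff nth_mem)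
    qed
    then have "{u. {u, v} \<in> path_edges ps} = {}" using False by blast
    then show ?thesis by simp
  qed
  then obtain a b where ab: "{u. {u, v} \<in> path_edges ps} \<subseteq> {a, b}" by blast
  then show "finite {u. {u, v} \<in> path_edges ps}"
    by (rule finite_subset) simp
  have "card {u. {u, v} \<in> path_edges ps} \<le> card {a, b}"
    using ab by (intro card_mono) auto
  also have "\<dots> \<le> 2" by (simp add: card_insert_if)
  finally show "card {u. {u, v} \<in> path_edges ps} \<le> 2" .
qed

text \<open>If all cycle edges were on the path, take the cycle vertex that comes last along the
  path. Both of its cycle neighbours would have to be its immediate predecessor on the path, but
  they are distinct for \<open>l \<ge> 3\<close>.\<close>

lemma path_edges_acyclic:
  assumes dist: "distinct ps" and inj: "inj_on f {0..<l}" and l: "l \<ge> 3"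
  shows "\<exists>i<l. {f i, f (Suc i mod l)} \<notin> path_edges ps"
proof (rule ccontr)
  assume "\<not> ?thesis"
  then have all: "{f i, f (Suc i mod l)} \<in> path_edges ps" if "i < l" for i
    using that by blast
  have in_ps: "f i \<in> set ps" if "i < l" for i
    using all[OF that] unfolding path_edges_def
    by (auto simp: doubleton_eq_iff)
  \<comment> \<open>The position of the cycle vertex \<open>f i\<close> on the path, unique because
    \<open>ps\<close> is distinct.\<close>
  define h where "h i = (THE j. j < length ps \<and> ps ! j = f i)" for i
  have h: "h i < length ps \<and> ps ! h i = f i" if "i < l" for i
    unfolding h_def
  proof (rule theI')
    show "\<exists>!j. j < length ps \<and> ps ! j = f i"
      using in_ps[OF that] dist by (metis distinct_Ex1)
  qed
  have h_eq: "i = j" if "i < l" "j < l" "h i = h j" for i j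
    using h[OF that(1)] h[OF that(2)] that inj unfolding inj_on_def by force
  have step: "h i = Suc (h j) \<or> h j = Suc (h i)" if ij: "i < l" "j = Suc i mod l" for i j
  proof -
    have j: "j < l" using ij by simp
    obtain m where m: "Suc m < length ps" "{f i, f j} = {ps ! m, ps ! Suc m}"
      using all[OF ij(1)] ij unfolding path_edges_def by blast
    have idx: "h i' = m'" if "i' < l" "m' < length ps" "f i' = ps ! m'" for i' m'
      using h[OF that(1)] that dist nth_eq_iff_index_eq by metis
    from m(2) consider "f i = ps ! m" "f j = ps ! Suc m" | "f i = ps ! Suc m" "f j = ps ! m"
      unfolding doubleton_eq_iff by blast
    then show ?thesis
      by cases (use idx[OF ij(1), of m] idx[OF ij(1), of "Suc m"]
        idx[OF j, of m] idx[OF j, of "Suc m"] m(1) in auto)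
  qed
  have fin: "finite (h ` {0..<l})" and ne: "h ` {0..<l} \<noteq> {}" using l by auto
  obtain t where t: "t < l" "h t = Max (h ` {0..<l})"
    using Max_in[OF fin ne] by auto
  have mx: "h i \<le> h t" if "i < l" for i using t fin that by simp
  \<comment> \<open>The cyclic successor and predecessor of \<open>t\<close>, the index of maximal
    position.\<close>
  define s where "s = Suc t mod l"
  define r where "r = (if t = 0 then l - 1 else t - 1)"
  have s: "s < l" and r: "r < l" "t = Suc r mod l"
    using t l by (auto simp: s_def r_def)
  have "h t = Suc (h s)" using step[OF t(1) s_def] mx[OF s] by auto
  moreover have "h t = Suc (h r)" using step[OF r] mx[OF r(1)] by auto
  ultimately have "r = s" using h_eq s r by simp
  then show False using t l unfolding r_def s_def
    by (cases "Suc t = l") (auto split: if_splits)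
qed

section \<open>Cycles as vertex lists and the weight of their edges\<close>

definition cycle_edge :: "'a list \<Rightarrow> nat \<Rightarrow> 'a set" where
  "cycle_edge xs i = {xs ! i, xs ! (Suc i mod length xs)}"

text \<open>Two different indices give the same edge only if each is the cyclic successor of the
  other, which forces length 2.\<close>

lemma inj_on_cycle_edge:
  assumes dist: "distinct xs" and l: "length xs \<ge> 3"
  shows "inj_on (cycle_edge xs) {..<length xs}"
proof (rule inj_onI)
  fix i j assume ij: "i \<in> {..<length xs}" "j \<in> {..<length xs}"
    and eq: "cycle_edge xs i = cycle_edge xs j"
  have lt: "Suc i mod length xs < length xs" "Suc j mod length xs < length xs"
    using l by (auto intro!: mod_less_divisor)
  show "i = j"
  proof (rule ccontr)
    assume ne: "i \<noteq> j"
    have "i = Suc j mod length xs" "j = Suc i mod length xs"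
      using eq ne ij lt dist unfolding cycle_edge_def doubleton_eq_iff
      by (auto simp: nth_eq_iff_index_eq)
    moreover have "Suc i mod length xs = (if Suc i = length xs then 0 else Suc i)"
      "Suc j mod length xs = (if Suc j = length xs then 0 else Suc j)" using ij by simp_all
    ultimately have i: "i = (if Suc j = length xs then 0 else Suc j)"
      and j: "j = (if Suc i = length xs then 0 else Suc i)" by metis+
    show False
    proof (cases "Suc i = length xs")
      case True
      then have "j = 0" using j by simp
      then have "i \<le> 1" using i by (simp split: if_splits)
      then show False using True l by simp
    next
      case False
      then have "j = Suc i" using j by simp
      then have "i = 0" "Suc j = length xs" using i by (simp_all split: if_splits)
      then show False using \<open>j = Suc i\<close> l by simp
    qed
  qed
qed

definition cycle_edges :: "'a list \<Rightarrow> 'a set set" where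
  "cycle_edges xs = cycle_edge xs ` {..<length xs}"

definition closing_edge :: "'a list \<Rightarrow> 'a set" where
  "closing_edge xs = {last xs, hd xs}"

text \<open>The conditional probability that an edge is present in the random graph, given that all
  of \<open>P\<close> is.\<close>

definition edge_factor :: "real \<Rightarrow> 'a set set \<Rightarrow> 'a \<Rightarrow> 'a \<Rightarrow> real" where
  "edge_factor p P u v = (if {u, v} \<in> P then 1 else p)"

text \<open>By injectivity of \<open>cycle_edge\<close>, the exponent exceeds \<open>card P\<close>
  by the number of indices whose edge is outside \<open>P\<close>. The closing edge is one of them
  and gives the separate factor \<open>p\<close>; the other edges give a product along the list, the
  shape that \<open>sum_walk_weights_le\<close> handles.\<close>

lemma power_card_cycle_Un:
  assumes P: "finite P" and dist: "distinct xs" and len: "length xs = Suc m" "m \<ge> 2"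
    and out: "closing_edge xs \<notin> P"
  shows "p ^ card (cycle_edges xs \<union> P)
    = p ^ card P * (p * (\<Prod>i<m. edge_factor p P (xs ! i) (xs ! Suc i)))"
proof -
  let ?e = "cycle_edge xs"
  have ne: "xs \<noteq> []" using len by auto
  have closing: "?e m = closing_edge xs"
    using len ne by (simp add: cycle_edge_def closing_edge_def last_conv_nth hd_conv_nth)
  have inj: "inj_on ?e {i. i < Suc m \<and> ?e i \<notin> P}"
    using inj_on_cycle_edge[OF dist] len by (auto intro: inj_on_subset)
  have diff: "cycle_edges xs - P = ?e ` {i. i < Suc m \<and> ?e i \<notin> P}"
    using len by (auto simp: cycle_edges_def)
  have "card (cycle_edges xs \<union> P) = card P + card (cycle_edges xs - P)"
    using P by (subst card_Un_disjoint[symmetric])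
      (auto simp: cycle_edges_def intro: arg_cong[where f = card])
  also have "card (cycle_edges xs - P) = card {i. i < Suc m \<and> ?e i \<notin> P}"
    unfolding diff by (rule card_image[OF inj])
  finally have card: "card (cycle_edges xs \<union> P)
    = card P + card {i. i < Suc m \<and> ?e i \<notin> P}" .
  have "p ^ card {i. i < Suc m \<and> ?e i \<notin> P} = (\<Prod>i | i < Suc m \<and> ?e i \<notin> P. p)"
    by simp
  also have "\<dots> = (\<Prod>i<Suc m. if ?e i \<in> P then 1 else p)"
    by (rule prod.mono_neutral_cong_left) auto
  also have "\<dots> = p * (\<Prod>i<m. if ?e i \<in> P then 1 else p)"
    using out by (simp add: closing)
  also have "(\<Prod>i<m. if ?e i \<in> P then 1 else p)
      = (\<Prod>i<m. edge_factor p P (xs ! i) (xs ! Suc i))"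
    using len by (intro prod.cong) (auto simp: edge_factor_def cycle_edge_def)
  finally show ?thesis by (simp add: card power_add)
qed

section \<open>Closed walks in the random graph and their expected number\<close>

definition complete_edges :: "'a set \<Rightarrow> 'a set set" where
  "complete_edges V = {e. e \<subseteq> V \<and> card e = 2}"

lemma finite_complete_edges: "finite V \<Longrightarrow> finite (complete_edges V)"
  by (simp add: complete_edges_def)

lemma path_edges_subset_complete_edges:
  assumes "distinct ps" "set ps \<subseteq> V"
  shows "path_edges ps \<subseteq> complete_edges V"
proof
  fix e assume "e \<in> path_edges ps"
  then obtain i where i: "Suc i < length ps" "e = {ps ! i, ps ! Suc i}"
    unfolding path_edges_def by blast
  then have "ps ! i \<noteq> ps ! Suc i" "ps ! i \<in> set ps" "ps ! Suc i \<in> set ps"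
    using assms(1) by (auto simp: nth_eq_iff_index_eq)
  then show "e \<in> complete_edges V" using i assms(2) by (auto simp: complete_edges_def)
qed

lemma card_path_edges_le:
  assumes "distinct ps" "set ps \<subseteq> V" "finite V"
  shows "card (path_edges ps) \<le> card V"
proof -
  have "path_edges ps \<subseteq> (\<lambda>i. {ps ! i, ps ! Suc i}) ` {..<length ps}"
    unfolding path_edges_def by auto
  then have "card (path_edges ps) \<le> card {..<length ps}"
    by (intro surj_card_le) auto
  also have "\<dots> \<le> card V"
    using assms by (metis card_lessThan card_mono distinct_card)
  finally show ?thesis .
qed

text \<open>A cycle that is not contained in \<open>P\<close> can be listed so that its closing edge lies outside \<open>P\<close>.\<close>

definition closed_walks :: "'a set \<Rightarrow> 'a set set \<Rightarrow> nat \<Rightarrow> 'a set set \<Rightarrow> 'a list set" where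
  "closed_walks V P l G = {xs. set xs \<subseteq> V \<and> length xs = l \<and> distinct xs
     \<and> closing_edge xs \<notin> P \<and> cycle_edges xs \<subseteq> G}"

lemma finite_closed_walks: "finite V \<Longrightarrow> finite (closed_walks V P l G)"
  by (rule finite_subset[OF _ finite_lists_length_eq[of V l]]) (auto simp: closed_walks_def)

lemma cycle_edges_subset_complete_edges:
  assumes "distinct xs" "length xs \<ge> 2" "set xs \<subseteq> V"
  shows "cycle_edges xs \<subseteq> complete_edges V"
proof
  fix e assume "e \<in> cycle_edges xs"
  then obtain i where i: "i < length xs" "e = {xs ! i, xs ! (Suc i mod length xs)}"
    by (auto simp: cycle_edges_def cycle_edge_def)
  have lt: "Suc i mod length xs < length xs" using i by (intro mod_less_divisor) auto
  have "i \<noteq> Suc i mod length xs" using i assms(2) by (cases "Suc i = length xs") auto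
  then have "xs ! i \<noteq> xs ! (Suc i mod length xs)"
    using lt i assms(1) by (simp add: nth_eq_iff_index_eq)
  moreover have "xs ! i \<in> V" "xs ! (Suc i mod length xs) \<in> V"
    using lt i assms(3) by auto
  ultimately show "e \<in> complete_edges V" using i by (auto simp: complete_edges_def)
qed

text \<open>Linearity of expectation: after swapping the sums, each list contributes the probability
  that its cycle and \<open>P\<close> are both present. The closing edge costs \<open>p\<close>, and
  the walk along the other \<open>m\<close> edges is bounded with
  \<open>D = p * card V + 2\<close>.\<close>

lemma expected_closed_walks_le:
  assumes fin: "finite V" and dist: "distinct ps" and sub: "set ps \<subseteq> V" and m: "m \<ge> 2"
    and p: "0 \<le> p"
  defines "P \<equiv> path_edges ps" and "E \<equiv> complete_edges V"
  shows "(\<Sum>G | G \<subseteq> E \<and> P \<subseteq> G. bernoulli_weight p E G * card (closed_walks V P (Suc m) G))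
    \<le> p ^ card P * (p * card V * (p * card V + 2) ^ m)"
proof -
  \<comment> \<open>Taking \<open>UNIV\<close> for the graph drops the containment condition, so
    \<open>W\<close> holds all candidates for every \<open>G\<close> at once.\<close>
  define W where "W = closed_walks V P (Suc m) UNIV"
  let ?\<G> = "{G. G \<subseteq> E \<and> P \<subseteq> G}"
  let ?L = "{xs. set xs \<subseteq> V \<and> length xs = Suc m}"
  let ?w = "\<lambda>xs. \<Prod>i<m. edge_factor p P (xs ! i) (xs ! Suc i)"
  have finE: "finite E" using fin by (simp add: E_def finite_complete_edges)
  have PE: "P \<subseteq> E" unfolding P_def E_def by (rule path_edges_subset_complete_edges[OF dist sub])
  have finP: "finite P" using PE finE finite_subset by blast
  have finG: "finite ?\<G>" using finE by simp
  have finW: "finite W" using fin unfolding W_def by (rule finite_closed_walks)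
  have walks: "closed_walks V P (Suc m) G = {xs \<in> W. cycle_edges xs \<subseteq> G}" for G
    by (auto simp: W_def closed_walks_def)
  have "(\<Sum>G\<in>?\<G>. bernoulli_weight p E G * card (closed_walks V P (Suc m) G))
      = (\<Sum>G\<in>?\<G>. \<Sum>xs\<in>W. if cycle_edges xs \<subseteq> G then bernoulli_weight p E G else 0)"
    by (rule sum.cong[OF refl])
      (simp add: walks sum.If_cases[OF finW] Int_def mult.commute)
  also have "\<dots> = (\<Sum>xs\<in>W. \<Sum>G\<in>?\<G>. if cycle_edges xs \<subseteq> G then bernoulli_weight p E G else 0)"
    by (rule sum.swap)
  also have "\<dots> = (\<Sum>xs\<in>W. p ^ card P * (p * ?w xs))"
  proof (rule sum.cong[OF refl])
    fix xs assume xs: "xs \<in> W"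
    then have sub: "cycle_edges xs \<union> P \<subseteq> E"
      using PE m cycle_edges_subset_complete_edges[of xs V]
      by (auto simp: W_def closed_walks_def E_def)
    have "(\<Sum>G\<in>?\<G>. if cycle_edges xs \<subseteq> G then bernoulli_weight p E G else 0)
        = (\<Sum>G | G \<subseteq> E \<and> cycle_edges xs \<union> P \<subseteq> G. bernoulli_weight p E G)"
      using finG by (simp add: sum.If_cases Int_def conj_ac)
    also have "\<dots> = p ^ card (cycle_edges xs \<union> P)"
      by (rule sum_bernoulli_weight_superset[OF finE sub])
    also have "\<dots> = p ^ card P * (p * ?w xs)"
      using xs m finP by (intro power_card_cycle_Un) (auto simp: W_def closed_walks_def)
    finally show "(\<Sum>G\<in>?\<G>. if cycle_edges xs \<subseteq> G then bernoulli_weight p E G else 0)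
      = p ^ card P * (p * ?w xs)" .
  qed
  \<comment> \<open>Distinctness and the condition on the closing edge have done their work; all
    lists may now be included because the terms are nonnegative.\<close>
  also have "\<dots> \<le> (\<Sum>xs\<in>?L. p ^ card P * (p * ?w xs))"
    using fin p by (intro sum_mono2 finite_lists_length_eq)
      (auto simp: W_def closed_walks_def edge_factor_def intro!: mult_nonneg_nonneg prod_nonneg)
  also have "\<dots> = p ^ card P * p * (\<Sum>xs\<in>?L. ?w xs)"
    by (simp add: sum_distrib_left mult.assoc)
  also have "\<dots> \<le> p ^ card P * p * (card V * (p * card V + 2) ^ m)"
  proof (intro mult_left_mono sum_walk_weights_le fin)
    fix v
    let ?N = "{u. {u, v} \<in> P}"
    \<comment> \<open>Every vertex costs at most \<open>p\<close>, plus an extra 1 for each of the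
      at most two neighbours of \<open>v\<close> along the path.\<close>
    have "(\<Sum>u\<in>V. edge_factor p P u v) \<le> (\<Sum>u\<in>V. p + (if u \<in> ?N then 1 else 0))"
      using p by (intro sum_mono) (auto simp: edge_factor_def)
    also have "\<dots> = p * card V + card (V \<inter> ?N)"
      using fin by (simp add: sum.distrib sum.If_cases mult.commute Int_def)
    also have "card (V \<inter> ?N) \<le> card ?N"
      using card_path_neighbours_le[OF dist, of v] by (intro card_mono) (auto simp: P_def)
    also have "card ?N \<le> 2"
      using card_path_neighbours_le[OF dist, of v] by (simp add: P_def)
    finally show "(\<Sum>u\<in>V. edge_factor p P u v) \<le> p * card V + 2" by simp
  qed (use p in \<open>auto simp: edge_factor_def\<close>)
  finally show ?thesis by (simp add: mult_ac)
qed

section \<open>Destroying all cycles by deleting closing edges\<close>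

text \<open>By \<open>path_edges_acyclic\<close> some edge of the copy is off the path; rotating the
  cycle turns it into the closing edge.\<close>

lemma copy_has_closed_walk:
  fixes V :: "'a set"
  assumes copy: "contains_copy (V, G) (cycle_graph l)" and l: "l \<ge> 3" and dist: "distinct ps"
  shows "closed_walks V (path_edges ps) l G \<noteq> {}"
proof -
  obtain f where inj: "inj_on f {0..<l}" and fV: "f ` {0..<l} \<subseteq> V"
    and fG: "\<And>e. e \<in> {{i, Suc i mod l} | i. i < l} \<Longrightarrow> f ` e \<in> G"
    using copy unfolding contains_copy_def cycle_graph_def by auto
  have edge: "{f i, f (Suc i mod l)} \<in> G" if "i < l" for i
  proof -
    have "f ` {i, Suc i mod l} \<in> G" using that by (intro fG) blast
    then show ?thesis by simp
  qed
  obtain i0 where i0: "i0 < l" "{f i0, f (Suc i0 mod l)} \<notin> path_edges ps"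
    using path_edges_acyclic[OF dist inj l] by blast
  \<comment> \<open>Starting at index \<open>Suc i0\<close> makes \<open>f i0\<close> the last
    entry, so the edge chosen above closes the list.\<close>
  define xs where "xs = map (\<lambda>i. f ((i + Suc i0) mod l)) [0..<l]"
  have len: "length xs = l" by (simp add: xs_def)
  have nth: "xs ! i = f ((i + Suc i0) mod l)" if "i < l" for i
    using that by (simp add: xs_def)
  have ne: "xs \<noteq> []" using len l by auto
  have "last xs = f i0"
  proof -
    have "l - 1 + Suc i0 = l + i0" using l by simp
    then show ?thesis using nth[of "l - 1"] ne len l i0 by (simp add: last_conv_nth)
  qed
  moreover have "hd xs = f (Suc i0 mod l)" using nth[of 0] ne l by (simp add: hd_conv_nth)
  ultimately have closing: "closing_edge xs \<notin> path_edges ps"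
    using i0 by (simp add: closing_edge_def)
  have "distinct xs"
    unfolding distinct_conv_nth len
  proof (intro allI impI)
    fix i j assume ij: "i < l" "j < l" "i \<noteq> j"
    have "(i + Suc i0) mod l \<noteq> (j + Suc i0) mod l"
    proof
      assume "(i + Suc i0) mod l = (j + Suc i0) mod l"
      then have "i mod l = j mod l" 
        unfolding nat_mod_eq_iff by auto
      then show False using ij by simp
    qed
    then show "xs ! i \<noteq> xs ! j"
      using ij l inj nth by (simp add: inj_on_eq_iff)
  qed
  moreover have "set xs \<subseteq> V"
    using fV l by (auto simp: xs_def)
  moreover have "cycle_edges xs \<subseteq> G"
  proof
    fix e assume "e \<in> cycle_edges xs"
    then obtain i where i: "i < l" "e = {xs ! i, xs ! (Suc i mod l)}"
      by (auto simp: cycle_edges_def cycle_edge_def len)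
    have "(Suc i mod l + Suc i0) mod l = Suc ((i + Suc i0) mod l) mod l"
      by (metis add_Suc add_Suc_right mod_Suc_eq mod_add_left_eq)
    then have "e = {f ((i + Suc i0) mod l), f (Suc ((i + Suc i0) mod l) mod l)}"
      using i l by (simp add: nth)
    then show "e \<in> G" using edge l by simp
  qed
  ultimately have "xs \<in> closed_walks V (path_edges ps) l G"
    using len closing by (simp add: closed_walks_def)
  then show ?thesis by blast
qed

lemma closing_edge_in_cycle_edges:
  assumes "xs \<noteq> []" shows "closing_edge xs \<in> cycle_edges xs"
proof -
  have "closing_edge xs = cycle_edge xs (length xs - 1)"
    using assms by (simp add: cycle_edge_def closing_edge_def last_conv_nth hd_conv_nth)
  then show ?thesis using assms by (auto simp: cycle_edges_def)
qed

lemma contains_copy_mono: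
  assumes "contains_copy (V, G) A" "G \<subseteq> G'" shows "contains_copy (V, G') A"
proof -
  obtain f where "inj_on f (vertices A)" "f ` vertices A \<subseteq> V" "\<forall>e\<in>edges A. f ` e \<in> G"
    using assms(1) by (auto simp: contains_copy_def)
  then show ?thesis
    using assms(2) unfolding contains_copy_def by (intro exI[of _ f]) auto
qed

text \<open>Confining \<open>D\<close> to few edges of the complete graph is what makes the possible
  deletion sets countable by \<open>card_subsets_le\<close>.\<close>

definition almost_free :: "'a set \<Rightarrow> nat \<Rightarrow> nat \<Rightarrow> 'a set set \<Rightarrow> 'a set set \<Rightarrow> 'a set set \<Rightarrow> bool" where
  "almost_free V l s P G D \<longleftrightarrow> D \<subseteq> complete_edges V \<and> card D \<le> s \<and> P \<subseteq> G - D
     \<and> \<not> contains_copy (V, G - D) (cycle_graph l)"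

text \<open>Delete the closing edge of every closed walk of \<open>G\<close>. These edges avoid the
  path, so the path survives. A cycle left over would give a closed walk of \<open>G\<close> whose
  own closing edge has been deleted.\<close>

lemma almost_free_if_few_closed_walks:
  assumes fin: "finite V" and dist: "distinct ps" and l: "l \<ge> 3"
    and P: "path_edges ps \<subseteq> G"
    and few: "card (closed_walks V (path_edges ps) l G) \<le> s"
  shows "\<exists>D. almost_free V l s (path_edges ps) G D"
proof
  let ?Z = "closed_walks V (path_edges ps) l G"
  let ?D = "closing_edge ` ?Z"
  have in_cycle: "closing_edge xs \<in> cycle_edges xs" if "xs \<in> closed_walks V (path_edges ps) l G'"
    for xs G'
    using that l by (intro closing_edge_in_cycle_edges) (auto simp: closed_walks_def)
  have "?D \<subseteq> complete_edges V"
  proof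
    fix e assume "e \<in> ?D"
    then obtain xs where xs: "xs \<in> ?Z" "e = closing_edge xs" by blast
    then have "cycle_edges xs \<subseteq> complete_edges V"
      using l by (intro cycle_edges_subset_complete_edges) (auto simp: closed_walks_def)
    then show "e \<in> complete_edges V" using in_cycle xs by blast
  qed
  moreover have "card ?D \<le> s"
    using few card_image_le[OF finite_closed_walks[OF fin], of closing_edge] le_trans by blast
  moreover have "path_edges ps \<subseteq> G - ?D"
    using P by (auto simp: closed_walks_def)
  moreover have "\<not> contains_copy (V, G - ?D) (cycle_graph l)"
  proof
    assume "contains_copy (V, G - ?D) (cycle_graph l)"
    then obtain xs where xs: "xs \<in> closed_walks V (path_edges ps) l (G - ?D)"
      using copy_has_closed_walk[OF _ l dist] by blast
    then have "xs \<in> ?Z" by (auto simp: closed_walks_def)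
    then have "closing_edge xs \<in> ?D" by blast
    moreover have "cycle_edges xs \<subseteq> G - ?D" using xs by (auto simp: closed_walks_def)
    ultimately show False using in_cycle[OF xs] by blast
  qed
  ultimately show "almost_free V l s (path_edges ps) G ?D"
    by (simp add: almost_free_def)
qed

section \<open>Markov's inequality and double counting\<close>

text \<open>Markov's inequality: \<open>s\<close> is at least twice the bound on the conditional
  expectation of the number \<open>Z\<close> of closed walks, and the indicator of
  \<open>Z \<le> s\<close> is at least \<open>1 - Z / s\<close>. So at least half of the mass of
  graphs containing \<open>P\<close> is good.\<close>

lemma prob_almost_free_ge:
  fixes p :: real
  assumes fin: "finite V" and dist: "distinct ps" and sub: "set ps \<subseteq> V" and m: "m \<ge> 2"
    and p: "0 < p" "p \<le> 1" and s: "s \<ge> 1" "2 * (p * card V * (p * card V + 2) ^ m) \<le> real s"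
  defines "P \<equiv> path_edges ps" and "E \<equiv> complete_edges V"
  shows "p ^ card V / 2 \<le>
    (\<Sum>G\<in>Pow E. if \<exists>D. almost_free V (Suc m) s P G D then bernoulli_weight p E G else 0)"
proof -
  let ?\<G> = "{G. G \<subseteq> E \<and> P \<subseteq> G}"
  let ?Z = "\<lambda>G. real (card (closed_walks V P (Suc m) G))"
  let ?w = "bernoulli_weight p E"
  let ?K = "p * card V * (p * card V + 2) ^ m"
  have finE: "finite E" using fin by (simp add: E_def finite_complete_edges)
  have PE: "P \<subseteq> E" unfolding P_def E_def by (rule path_edges_subset_complete_edges[OF dist sub])
  have w: "0 \<le> ?w G" for G using p by (intro bernoulli_weight_nonneg) auto
  have "p ^ card V / 2 \<le> p ^ card P / 2"
    using p card_path_edges_le[OF dist sub fin] by (auto simp: P_def intro: power_decreasing)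
  also have "\<dots> \<le> p ^ card P - p ^ card P * ?K / s"
  proof -
    have "p ^ card P * (?K / s) \<le> p ^ card P * (1 / 2)"
      using s p by (intro mult_left_mono) (auto simp: field_simps)
    then show ?thesis by simp
  qed
  also have "\<dots> \<le> (\<Sum>G\<in>?\<G>. ?w G) - (\<Sum>G\<in>?\<G>. ?w G * ?Z G) / s"
  proof (intro diff_mono divide_right_mono)
    show "p ^ card P \<le> (\<Sum>G\<in>?\<G>. ?w G)"
      using sum_bernoulli_weight_superset[OF finE PE] by simp
    show "(\<Sum>G\<in>?\<G>. ?w G * ?Z G) \<le> p ^ card P * ?K"
      using expected_closed_walks_le[OF fin dist sub m, of p] p by (simp add: P_def E_def add.commute)
  qed simp
  also have "\<dots> = (\<Sum>G\<in>?\<G>. ?w G * (1 - ?Z G / s))"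
    by (simp add: sum_subtractf right_diff_distrib sum_divide_distrib)
  also have "\<dots> \<le> (\<Sum>G\<in>?\<G>. if \<exists>D. almost_free V (Suc m) s P G D then ?w G else 0)"
  proof (rule sum_mono)
    fix G assume G: "G \<in> ?\<G>"
    show "?w G * (1 - ?Z G / s) \<le> (if \<exists>D. almost_free V (Suc m) s P G D then ?w G else 0)"
    proof (cases "?Z G \<le> s")
      case True
      then have "\<exists>D. almost_free V (Suc m) s P G D"
        unfolding P_def using G m
        by (intro almost_free_if_few_closed_walks fin dist) (auto simp: P_def)
      moreover have "?w G * (1 - ?Z G / s) \<le> ?w G"
        using w[of G] by (intro mult_left_le) auto
      ultimately show ?thesis by simp
    next
      case False
      then have "1 - ?Z G / s \<le> 0" using s by (simp add: field_simps)
      then have "?w G * (1 - ?Z G / s) \<le> 0" using w[of G] by (simp add: mult_nonneg_nonpos)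
      then show ?thesis using w[of G] by (auto intro: order_trans)
    qed
  qed
  also have "\<dots> \<le> (\<Sum>G\<in>Pow E. if \<exists>D. almost_free V (Suc m) s P G D then ?w G else 0)"
    using finE w by (intro sum_mono2) auto
  finally show ?thesis .
qed

text \<open>Double counting of pairs of a path and a graph that is good for it: each path has good
  graphs of total weight at least \<open>p ^ n / 2\<close>, while each graph is good for at most as
  many paths as there are deletion sets.\<close>

lemma card_creating_le:
  fixes p :: real
  assumes F: "F \<subseteq> paths_on n" and create: "pairwise (creating (cycle_graph (Suc m))) F"
    and m: "m \<ge> 2" and p: "0 < p" "p \<le> 1"
    and s: "s \<ge> 1" "2 * (p * n * (p * n + 2) ^ m) \<le> real s"
  shows "card F * p ^ n \<le> 2 * (real n ^ 2 + 1) ^ s"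
proof -
  define V where "V = {1..n}"
  define E where "E = complete_edges V"
  let ?w = "bernoulli_weight p E"
  let ?good = "\<lambda>x G. \<exists>D. almost_free V (Suc m) s (edges x) G D"
  let ?N = "(real n ^ 2 + 1) ^ s"
  have finV: "finite V" and cardV: "card V = n" by (simp_all add: V_def)
  have finE: "finite E" using finV by (simp add: E_def finite_complete_edges)
  have finF: "finite F" using F finite_paths_on finite_subset by blast
  have w: "0 \<le> ?w G" for G using p by (intro bernoulli_weight_nonneg) auto
  have cardE: "card E \<le> n ^ 2"
  proof -
    have "card E = n choose 2" unfolding E_def complete_edges_def
      using n_subsets[OF finV, of 2] cardV by simp
    then show ?thesis
      by (cases "2 \<le> n") (auto intro: binomial_le_pow simp: not_le binomial_eq_0)
  qed
  have path: "p ^ n / 2 \<le> (\<Sum>G\<in>Pow E. if ?good x G then ?w G else 0)" if x: "x \<in> F" for x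
  proof -
    obtain ps where "x = (V, path_edges ps)" "distinct ps" "set ps \<subseteq> V"
      using x F unfolding paths_on_def V_def by blast
    then show ?thesis
      unfolding E_def using prob_almost_free_ge[OF finV, of ps m p s] m p s by (simp add: cardV)
  qed
  have few: "card {x \<in> F. ?good x G} \<le> ?N" for G
  proof -
    define D where "D x = (SOME D. almost_free V (Suc m) s (edges x) G D)" for x :: "nat sgraph"
    have D: "almost_free V (Suc m) s (edges x) G (D x)" if "?good x G" for x
      unfolding D_def using that by (rule someI_ex)
    \<comment> \<open>Two paths with the same deletion set would both lie in the same cycle-free
      graph \<open>G - D x\<close>, although their union contains the cycle.\<close>
    have "inj_on D {x \<in> F. ?good x G}"
    proof (rule inj_onI, rule ccontr)
      fix x y assume x: "x \<in> {x \<in> F. ?good x G}" and y: "y \<in> {x \<in> F. ?good x G}"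
        and eq: "D x = D y" and ne: "x \<noteq> y"
      have V: "fst x = V" "fst y = V"
        using x y F by (auto simp: paths_on_def V_def)
      have "creating (cycle_graph (Suc m)) x y"
        using create x y ne by (auto simp: pairwise_def)
      then have "contains_copy (V, edges x \<union> edges y) (cycle_graph (Suc m))"
        by (simp add: creating_def graph_union_def V)
      moreover have "edges x \<union> edges y \<subseteq> G - D x"
        using D[of x] D[of y] x y eq by (auto simp: almost_free_def)
      ultimately have "contains_copy (V, G - D x) (cycle_graph (Suc m))"
        by (rule contains_copy_mono)
      then show False using D[of x] x by (auto simp: almost_free_def)
    qed
    moreover have "D ` {x \<in> F. ?good x G} \<subseteq> {D. D \<subseteq> E \<and> card D \<le> s}"
      using D by (auto simp: almost_free_def E_def)
    moreover have "finite {D. D \<subseteq> E \<and> card D \<le> s}" using finE by simp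
    ultimately have "card {x \<in> F. ?good x G} \<le> card {D. D \<subseteq> E \<and> card D \<le> s}"
      by (rule card_inj_on_le)
    also have "\<dots> \<le> (card E + 1) ^ s" by (rule card_subsets_le[OF finE])
    also have "\<dots> \<le> (n ^ 2 + 1) ^ s" using cardE by (intro power_mono) auto
    finally have "real (card {x \<in> F. ?good x G}) \<le> real ((n ^ 2 + 1) ^ s)"
      by (rule of_nat_mono)
    then show ?thesis by (simp add: add.commute)
  qed
  have "card F * (p ^ n / 2) = (\<Sum>x\<in>F. p ^ n / 2)" by simp
  also have "\<dots> \<le> (\<Sum>x\<in>F. \<Sum>G\<in>Pow E. if ?good x G then ?w G else 0)"
    by (intro sum_mono path)
  also have "\<dots> = (\<Sum>G\<in>Pow E. \<Sum>x\<in>F. if ?good x G then ?w G else 0)"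
    by (rule sum.swap)
  also have "\<dots> = (\<Sum>G\<in>Pow E. ?w G * card {x \<in> F. ?good x G})"
    using finF by (simp add: sum.If_cases Int_def mult.commute)
  also have "\<dots> \<le> (\<Sum>G\<in>Pow E. ?w G * ?N)"
    by (intro sum_mono mult_left_mono few w)
  also have "\<dots> = (\<Sum>G\<in>Pow E. ?w G) * ?N"
    by (simp add: sum_distrib_right)
  also have "(\<Sum>G\<in>Pow E. ?w G) = 1"
    using sum_bernoulli_weight_superset[OF finE, of "{}" p] by (simp add: Pow_def)
  finally show ?thesis by simp
qed

section \<open>Choice of the edge probability and asymptotics\<close>

lemma H_even_cycle_le:
  fixes k :: nat and a C :: real
  assumes k: "k \<ge> 2"
  defines "a \<equiv> 1 / (2 * real k)" and "C \<equiv> 2 * 3 ^ (2 * k)"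
  shows "\<forall>\<^sub>F n in sequentially. real (H n (2 * k)) \<le>
    exp (ln 2 + real n * (ln n - a * (ln n - ln (ln n)))
      + (C * n / ln n + 2) * ln ((real n)\<^sup>2 + 1))"
proof -
  have a: "0 < a" "a \<le> 1" using k by (simp_all add: a_def)
  have "\<forall>\<^sub>F n::nat in sequentially. 1 \<le> real n / ln n"
    "\<forall>\<^sub>F n::nat in sequentially. 1 \<le> ln (real n)"
    by real_asymp+
  then show ?thesis
    using eventually_gt_at_top[of 0]
  proof eventually_elim
    case (elim n)
    define d where "d = (real n / ln n) powr a"
    define p where "p = d / n"
    \<comment> \<open>The number of deleted edges allowed: twice the expectation bound rounded up,
      with 1 added to keep it positive. Both roundings together account for the \<open>+ 2\<close>
      in the statement.\<close>
    define s where "s = nat \<lceil>C * n / ln n\<rceil> + 1"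
    have d1: "1 \<le> d" using elim a by (simp add: d_def ge_one_powr_ge_zero)
    have "d \<le> (real n / ln n) powr 1"
      unfolding d_def using elim a by (intro powr_mono) auto
    also have "\<dots> \<le> n"
      using elim by (simp add: divide_le_eq)
    finally have p: "0 < p" "p \<le> 1" using d1 elim by (simp_all add: p_def)
    have d_pow: "d ^ (2 * k) = real n / ln n"
    proof -
      have "0 < real n / ln n" using elim by simp
      moreover have "real (2 * k) * a = 1" using k by (simp add: a_def)
      ultimately show ?thesis
        by (metis d_def mult.commute powr_one powr_powr powr_realpow powr_gt_zero less_irrefl less_imp_le)
    qed
    have Cn: "0 \<le> C * n / ln n" using elim by (simp add: C_def)
    have s_ge: "C * n / ln n \<le> s" and s_le: "s \<le> C * n / ln n + 2"
      using Cn unfolding s_def by linarith+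
    have pn: "p * n = d" using elim by (simp add: p_def)
    have "2 * (p * n * (p * n + 2) ^ (2 * k - 1)) = 2 * (d * (d + 2) ^ (2 * k - 1))"
      by (simp only: pn)
    \<comment> \<open>Since \<open>d \<ge> 1\<close>, both \<open>d\<close> and \<open>d + 2\<close>
      are at most \<open>3 * d\<close>; this is the source of the constant \<open>C\<close>.\<close>
    also have "\<dots> \<le> 2 * ((3 * d) * (3 * d) ^ (2 * k - 1))"
      using d1 by (intro mult_left_mono mult_mono power_mono) auto
    also have "(3 * d) * (3 * d) ^ (2 * k - 1) = (3 * d) ^ (2 * k)"
      using k by (subst power_Suc[symmetric]) (auto simp: Suc_diff_le)
    also have "2 * (3 * d) ^ (2 * k) = C * n / ln n"
      by (simp add: power_mult_distrib d_pow C_def)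
    finally have s: "s \<ge> 1" "2 * (p * n * (p * n + 2) ^ (2 * k - 1)) \<le> s"
      using s_ge by (auto simp: s_def)
    obtain F where F: "F \<subseteq> paths_on n" "pairwise (creating (cycle_graph (2 * k))) F"
      "card F = H n (2 * k)"
      using H_attained by blast
    have "Suc (2 * k - 1) = 2 * k" using k by simp
    then have "H n (2 * k) * p ^ n \<le> 2 * (real n ^ 2 + 1) ^ s"
      using card_creating_le[of F n "2 * k - 1" p s] F k p s by simp
    also have "\<dots> = exp (ln 2 + s * ln ((real n)\<^sup>2 + 1))"
      using add_nonneg_pos[of "(real n)\<^sup>2" 1] by (simp add: exp_add exp_of_nat_mult)
    also have "\<dots> \<le> exp (ln 2 + (C * n / ln n + 2) * ln ((real n)\<^sup>2 + 1))"
      using s_le by (intro iffD2[OF exp_le_cancel_iff] add_left_mono mult_right_mono) auto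
    finally have "H n (2 * k) \<le> exp (ln 2 + (C * n / ln n + 2) * ln ((real n)\<^sup>2 + 1)) / p ^ n"
      using p by (simp add: pos_le_divide_eq)
    also have "p ^ n = exp (- (real n * (ln n - a * (ln n - ln (ln n)))))"
    proof -
      have "ln p = a * (ln n - ln (ln n)) - ln n"
        using d1 elim by (simp add: p_def d_def ln_div ln_powr)
      then have "real n * ln p = - (real n * (ln n - a * (ln n - ln (ln n))))"
        by (simp add: right_diff_distrib)
      moreover have "p ^ n = exp (real n * ln p)"
        using p by (simp add: exp_of_nat_mult)
      ultimately show ?thesis by simp
    qed
    finally show ?case
      by (simp add: exp_diff[symmetric] algebra_simps)
  qed
qed

text \<open>Weakening the exponent saving from \<open>1 / (2 * real k)\<close> to any smaller
  \<open>c\<close> lets one statement serve all three cases.\<close>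

lemma H_even_cycle_powr_le:
  fixes k :: nat and c :: real
  assumes k: "k \<ge> 2" and c: "c \<le> 1 / (2 * real k)"
  shows "\<exists>f :: nat \<Rightarrow> real. (\<lambda>n. f n / real n) \<longlonglongrightarrow> 0 \<and>
    (\<forall>\<^sub>F n in sequentially. real (H n (2 * k)) \<le> real n powr ((1 - c) * real n - f n))"
proof (intro exI conjI)
  define a where "a = 1 / (2 * real k)"
  define C where "C = (2 * 3 ^ (2 * k) :: real)"
  define L where "L n = ln 2 + real n * (ln n - a * (ln n - ln (ln n)))
      + (C * n / ln n + 2) * ln ((real n)\<^sup>2 + 1)" for n :: nat
  \<comment> \<open>If \<open>c < a\<close>, the bound has linear room to spare; the truncation at \<open>0\<close> keeps \<open>f n = o(n)\<close>.\<close>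
  let ?f = "\<lambda>n. min 0 ((1 - c) * real n - L n / ln n)"
  \<comment> \<open>The \<open>ln (ln n)\<close> correction has order n ln ln n and the deletion
    term order n, both negligible against n ln n.\<close>
  have "(\<lambda>n. L n / (real n * ln n)) \<longlonglongrightarrow> 1 - a"
    unfolding L_def by real_asymp
  then have "(\<lambda>n. min 0 ((1 - c) - L n / (real n * ln n))) \<longlonglongrightarrow> min 0 ((1 - c) - (1 - a))"
    by (intro tendsto_intros)
  moreover have "min 0 ((1 - c) - (1 - a)) = 0" using c by (simp add: a_def)
  moreover have "\<forall>\<^sub>F n in sequentially. min 0 ((1 - c) - L n / (real n * ln n)) = ?f n / real n"
    using eventually_gt_at_top[of 0]
  proof eventually_elim
    case (elim n)
    have "min 0 y / real n = min 0 (y / real n)" for y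
      using elim by (auto simp: min_def field_simps)
    moreover have "((1 - c) * real n - L n / ln n) / real n = (1 - c) - L n / (real n * ln n)"
      using elim by (simp add: diff_divide_distrib mult.commute)
    ultimately show ?case by simp
  qed
  ultimately show "(\<lambda>n. ?f n / real n) \<longlonglongrightarrow> 0"
    using tendsto_cong by force
  show "\<forall>\<^sub>F n in sequentially. real (H n (2 * k)) \<le> real n powr ((1 - c) * real n - ?f n)"
    using H_even_cycle_le[OF k] eventually_gt_at_top[of 1]
  proof eventually_elim
    case (elim n)
    have "real (H n (2 * k)) \<le> exp (L n)"
      using elim by (simp add: L_def a_def C_def)
    also have "\<dots> = real n powr (L n / ln n)"
      using elim by (simp add: powr_def)
    also have "\<dots> \<le> real n powr ((1 - c) * real n - ?f n)"
      using elim by (intro powr_mono) auto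
    finally show ?case .
  qed
qed

theorem theorem1p5:
  fixes k :: nat
  assumes "k \<ge> 2"
  shows "(k \<in> {2, 3, 5} \<longrightarrow>
      (\<exists>f :: nat \<Rightarrow> real. (\<lambda>n. f n / real n) \<longlonglongrightarrow> 0 \<and>
        (\<forall>\<^sub>F n in sequentially. real (H n (2 * k))
           \<le> real n powr ((1 - 1 / (real k)\<^sup>2) * real n - f n))))
    \<and> (k \<notin> {2, 3, 5} \<and> even k \<longrightarrow>
      (\<exists>f :: nat \<Rightarrow> real. (\<lambda>n. f n / real n) \<longlonglongrightarrow> 0 \<and>
        (\<forall>\<^sub>F n in sequentially. real (H n (2 * k))
           \<le> real n powr ((1 - 2 / (3 * (real k)\<^sup>2 - 2 * real k)) * real n - f n))))
    \<and> (k \<notin> {2, 3, 5} \<and> odd k \<longrightarrow>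
      (\<exists>f :: nat \<Rightarrow> real. (\<lambda>n. f n / real n) \<longlonglongrightarrow> 0 \<and>
        (\<forall>\<^sub>F n in sequentially. real (H n (2 * k))
           \<le> real n powr ((1 - 2 / (3 * (real k)\<^sup>2 - 3 * real k)) * real n - f n))))"
proof (intro conjI impI)
  have k: "real k \<ge> 2" using assms by simp
  \<comment> \<open>Both remaining denominators factor as \<open>real k * b\<close>, with
    \<open>b\<close> equal to \<open>3 * real k - 2\<close> or
    \<open>3 * real k - 3\<close>.\<close>
  have le: "2 / (real k * b) \<le> 1 / (2 * real k)" if "b \<ge> 4" for b
    using k that by (simp add: field_simps)
  show "\<exists>f :: nat \<Rightarrow> real. (\<lambda>n. f n / real n) \<longlonglongrightarrow> 0 \<and>
    (\<forall>\<^sub>F n in sequentially. real (H n (2 * k)) \<le> real n powr ((1 - 1 / (real k)\<^sup>2) * real n - f n))"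
    using k by (intro H_even_cycle_powr_le assms) (simp add: power2_eq_square field_simps)
  show "\<exists>f :: nat \<Rightarrow> real. (\<lambda>n. f n / real n) \<longlonglongrightarrow> 0 \<and>
    (\<forall>\<^sub>F n in sequentially. real (H n (2 * k))
      \<le> real n powr ((1 - 2 / (3 * (real k)\<^sup>2 - 2 * real k)) * real n - f n))"
    using le[of "3 * real k - 2"] k
    by (intro H_even_cycle_powr_le assms) (simp add: power2_eq_square algebra_simps)
  assume "k \<notin> {2, 3, 5} \<and> odd k"
  \<comment> \<open>Here \<open>b = 3 * real k - 3\<close> reaches 4 only from k = 3 on.\<close>
  then have "real k \<ge> 3" using assms by (cases "k = 2") auto
  then show "\<exists>f :: nat \<Rightarrow> real. (\<lambda>n. f n / real n) \<longlonglongrightarrow> 0 \<and>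
    (\<forall>\<^sub>F n in sequentially. real (H n (2 * k))
      \<le> real n powr ((1 - 2 / (3 * (real k)\<^sup>2 - 3 * real k)) * real n - f n))"
    using le[of "3 * real k - 3"]
    by (intro H_even_cycle_powr_le assms) (simp add: power2_eq_square algebra_simps)
qed
end
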